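(* For every $s\in\mathbb{N}$ with $s\ge 2$ and every $u>0$ there is a constant $C(s,u)>0$ depending only on $s$ and $u$ such that for any system $I_1,\ldots,I_s\subset\mathbb{R}$ of pairwise disjoint closed segments with $\sigma/D\ge u$ we have $$E_n(I_1,\ldots,I_s)\le\left(C(s,u)\frac{\delta}{D}\right)^{\lfloor\frac{n+1}{s}\rfloor}\quad\text{for all } n\in\mathbb{N}.$$
   Context: Let $I_1,\ldots,I_s$ be pairwise disjoint closed bounded intervals (segments) on the real line and $K:=I_1\sqcup\ldots\sqcup I_s$. Let $\mathcal{P}_n$ be the set of real algebraic polynomials of degree at most $n$, $\mathbf{1}_I$ the indicator function of $I$, and $\|g\|_{C(K)}:=\max_{t\in K}|g(t)|$. For $f\in C(K)$ put $E_n(f)_K:=\min_{P\in\mathcal{P}_n}\|f-P\|_{C(K)}$, and define $$E_n(I_1,\ldots,I_s):=\max_{y_1,\ldots,y_s\in[-1,1]}E_n\Big(\sum_{i=1}^s y_i\mathbf{1}_{I_i}\Big)_K.$$ Further, $\delta:=\frac12\max_i|I_i|$ (half of the maximal length), $\sigma:=\min_{i\ne j}\min_{x\in I_i,\,y\in I_j}|x-y|$, and $D:=\operatorname{diam}(I_1\cup\ldots\cup I_s)$. A zeroth power equals $1$. *)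

theory Defs
  imports "HOL-Analysis.Analysis" "HOL-Computational_Algebra.Polynomial"
begin

definition segment :: "real set \<Rightarrow> bool" where
  "segment J \<longleftrightarrow> (\<exists>a b. a \<le> b \<and> J = {a..b})"

(* Minima and maxima over infinite sets are written as INF and SUP. For a nonempty compact K
   and f continuous on K all of them are attained. *)

definition norm_C :: "real set \<Rightarrow> (real \<Rightarrow> real) \<Rightarrow> real" where
  "norm_C K g = (SUP t\<in>K. \<bar>g t\<bar>)"

definition best_approx :: "nat \<Rightarrow> (real \<Rightarrow> real) \<Rightarrow> real set \<Rightarrow> real" where
  "best_approx n f K = (INF P\<in>{P :: real poly. degree P \<le> n}. norm_C K (\<lambda>t. f t - poly P t))"

(* A system I_1, ..., I_s is the restriction of I :: nat => real set to the index set {1..s}. *)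

definition system_union :: "nat \<Rightarrow> (nat \<Rightarrow> real set) \<Rightarrow> real set" where
  "system_union s I = (\<Union>i\<in>{1..s}. I i)"

definition best_approx_system :: "nat \<Rightarrow> nat \<Rightarrow> (nat \<Rightarrow> real set) \<Rightarrow> real" where
  "best_approx_system n s I =
     (SUP y\<in>{1..s} \<rightarrow> {-1..1}.
        best_approx n (\<lambda>t. \<Sum>i=1..s. y i * indicator (I i) t) (system_union s I))"

definition half_max_length :: "nat \<Rightarrow> (nat \<Rightarrow> real set) \<Rightarrow> real" where
  "half_max_length s I = 1/2 * Max ((\<lambda>i. measure lborel (I i)) ` {1..s})"

definition min_gap :: "nat \<Rightarrow> (nat \<Rightarrow> real set) \<Rightarrow> real" where
  "min_gap s I = Min {setdist (I i) (I j) | i j. i \<in> {1..s} \<and> j \<in> {1..s} \<and> i \<noteq> j}"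

end

(* With m = (n + 1) div s, the approximant is the Hermite interpolant of multiplicity m at the
   midpoints c_i. Its i-th fundamental polynomial is the product over j ~= i of
   ((c_j - x) / (c_j - c_i))^m times the Taylor polynomial of degree m - 1 at c_i of the inverse of
   that product. The product has a zero of order m in every other segment, which gives the factor
   (delta/D)^m there. On I_i the factor comes from the truncation error, estimated by inverting the
   linear factors one after the other. If delta/D is not small, the zero polynomial suffices. *)
theory Submission
  imports Defs
begin

section \<open>Truncated inverses of products of linear factors\<close>

lemma poly_eq_sum_atMost:
  fixes p :: "'a :: comm_semiring_1 poly"
  assumes "degree p \<le> n"
  shows "poly p x = (\<Sum>k\<le>n. coeff p k * x ^ k)"
proof -
  have "poly p x = poly (\<Sum>k\<le>n. monom (coeff p k) k) x"
    by (simp only: poly_as_sum_of_monoms'[OF assms])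
  then show ?thesis by (simp add: poly_sum poly_monom)
qed

text \<open>The \<open>h k\<close> are the power series coefficients of the quotient of
  \<open>\<Sum> c k * t ^ k\<close> by \<open>1 - \<beta> * t\<close>. After multiplying back,
  truncation at degree \<open>n\<close> leaves a single term of degree \<open>n + 1\<close>, so no
  tail has to be summed.\<close>

lemma truncated_quotient_linear:
  fixes c h :: "nat \<Rightarrow> real" and \<beta> t :: real
  assumes "h 0 = c 0" "\<And>k. h (Suc k) = c (Suc k) + \<beta> * h k"
  shows "(1 - \<beta> * t) * (\<Sum>k\<le>n. h k * t ^ k) = (\<Sum>k\<le>n. c k * t ^ k) - \<beta> * h n * t ^ Suc n"
proof -
  have "c (Suc k) = h (Suc k) - \<beta> * h k" for k using assms(2) by simp
  note c = assms(1)[symmetric] this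
  show ?thesis
    by (induction n) (simp_all add: c ring_distribs mult_ac)
qed

text \<open>\<open>T\<close> is the Taylor polynomial at 0 of the inverse of the product, built by
  dividing by one factor at a time. Its coefficients are at most \<open>v ^ k\<close> times a
  polynomial in \<open>k\<close>; the ratio \<open>2 * v\<close> absorbs that polynomial, so each
  factor costs only a constant independent of \<open>n\<close>.\<close>

lemma truncated_inverse:
  fixes \<beta> :: "'a \<Rightarrow> real" and v :: real
  assumes "finite A" "v \<ge> 0" "\<And>a. a \<in> A \<Longrightarrow> \<bar>\<beta> a\<bar> \<le> v"
  shows "\<exists>T. degree T \<le> n \<and> (\<forall>k. \<bar>coeff T k\<bar> \<le> 2 ^ card A * (2 * v) ^ k) \<and>
    (\<forall>t. v * \<bar>t\<bar> \<le> 1 \<longrightarrow>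
      \<bar>1 - poly T t * (\<Prod>a\<in>A. 1 - \<beta> a * t)\<bar> \<le> 4 ^ card A * (2 * v * \<bar>t\<bar>) ^ Suc n)"
  using assms(1,3)
proof (induction A rule: finite_induct)
  case empty
  show ?case
    using \<open>v \<ge> 0\<close> by (intro exI[of _ 1]) simp
next
  case (insert a A)
  then obtain T where T: "degree T \<le> n" "\<And>k. \<bar>coeff T k\<bar> \<le> 2 ^ card A * (2 * v) ^ k"
    "\<And>t. v * \<bar>t\<bar> \<le> 1 \<Longrightarrow>
      \<bar>1 - poly T t * (\<Prod>a\<in>A. 1 - \<beta> a * t)\<bar> \<le> 4 ^ card A * (2 * v * \<bar>t\<bar>) ^ Suc n"
    by auto
  have \<beta>: "\<bar>\<beta> a\<bar> \<le> v" "\<And>b. b \<in> A \<Longrightarrow> \<bar>\<beta> b\<bar> \<le> v"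
    using insert.prems by auto
  \<comment> \<open>Coefficients of the full power series of
    \<open>poly T t / (1 - \<beta> a * t)\<close>; they are cut off only in
    \<open>T'\<close>.\<close>
  define h where "h = rec_nat (coeff T 0) (\<lambda>k x. coeff T (Suc k) + \<beta> a * x)"
  have h: "h 0 = coeff T 0" "\<And>k. h (Suc k) = coeff T (Suc k) + \<beta> a * h k"
    by (simp_all add: h_def)
  have h_le: "\<bar>h k\<bar> \<le> 2 ^ card (insert a A) * (2 * v) ^ k" for k
  proof (induction k)
    case 0
    show ?case using T(2)[of 0] insert.hyps by (simp add: h)
  next
    case (Suc k)
    have "\<bar>h (Suc k)\<bar> \<le> \<bar>coeff T (Suc k)\<bar> + \<bar>\<beta> a\<bar> * \<bar>h k\<bar>"
      unfolding h by (metis abs_mult abs_triangle_ineq)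
    \<comment> \<open>Both summands equal \<open>2 ^ card A * (2 * v) ^ Suc k\<close>, because
      \<open>v * 2 * (2 * v) ^ k = (2 * v) ^ Suc k\<close>. Their sum is the doubling allowed per
      linear factor.\<close>
    also have "\<dots> \<le> 2 ^ card A * (2 * v) ^ Suc k + v * (2 ^ card (insert a A) * (2 * v) ^ k)"
      by (intro add_mono mult_mono T(2) Suc.IH \<beta>(1) \<open>v \<ge> 0\<close> abs_ge_zero)
    also have "\<dots> = 2 ^ card (insert a A) * (2 * v) ^ Suc k"
      using insert.hyps by simp
    finally show ?case .
  qed
  define T' where "T' = (\<Sum>k\<le>n. monom (h k) k)"
  have coeff_T': "coeff T' k = (if k \<le> n then h k else 0)" for k
    by (simp add: T'_def coeff_sum)
  have "degree T' \<le> n"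
    by (rule degree_le) (simp add: coeff_T')
  moreover have "\<bar>coeff T' k\<bar> \<le> 2 ^ card (insert a A) * (2 * v) ^ k" for k
    using h_le[of k] \<open>v \<ge> 0\<close> by (simp add: coeff_T' split: if_splits)
  moreover have "\<bar>1 - poly T' t * (\<Prod>a\<in>insert a A. 1 - \<beta> a * t)\<bar>
      \<le> 4 ^ card (insert a A) * (2 * v * \<bar>t\<bar>) ^ Suc n" if t: "v * \<bar>t\<bar> \<le> 1" for t
  proof -
    define q where "q = (\<Prod>a\<in>A. 1 - \<beta> a * t)"
    define w where "w = (2 * v * \<bar>t\<bar>) ^ Suc n"
    have "w \<ge> 0" using \<open>v \<ge> 0\<close> by (simp add: w_def)
    have "\<bar>1 - \<beta> b * t\<bar> \<le> 2" if "b \<in> A" for b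
    proof -
      have "\<bar>\<beta> b * t\<bar> \<le> v * \<bar>t\<bar>"
        using \<beta>(2)[OF that] by (simp add: abs_mult mult_right_mono)
      then show ?thesis using t by linarith
    qed
    then have q_le: "\<bar>q\<bar> \<le> 2 ^ card A"
      unfolding q_def abs_prod using prod_mono[of A "\<lambda>b. \<bar>1 - \<beta> b * t\<bar>" "\<lambda>_. 2"] by simp
    have "poly T' t = (\<Sum>k\<le>n. h k * t ^ k)"
      by (simp add: T'_def poly_sum poly_monom)
    moreover have "poly T t = (\<Sum>k\<le>n. coeff T k * t ^ k)"
      by (rule poly_eq_sum_atMost) (rule T(1))
    ultimately have "(1 - \<beta> a * t) * poly T' t = poly T t - \<beta> a * h n * t ^ Suc n"
      using truncated_quotient_linear[OF h, of t n] by simp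
    then have "poly T' t * ((1 - \<beta> a * t) * q) = (poly T t - \<beta> a * h n * t ^ Suc n) * q"
      by (metis mult.assoc mult.commute)
    \<comment> \<open>The new error is the old one plus the remainder of the last division,
      multiplied by the product \<open>q\<close> of the earlier factors.\<close>
    then have "1 - poly T' t * ((1 - \<beta> a * t) * q)
        = (1 - poly T t * q) + q * (\<beta> a * h n * t ^ Suc n)"
      by (simp add: algebra_simps)
    then have "\<bar>1 - poly T' t * ((1 - \<beta> a * t) * q)\<bar>
        \<le> \<bar>1 - poly T t * q\<bar> + \<bar>q\<bar> * (\<bar>\<beta> a\<bar> * \<bar>h n\<bar> * \<bar>t\<bar> ^ Suc n)"
      by (metis abs_mult abs_triangle_ineq power_abs)
    also have "\<dots> \<le> 4 ^ card A * w
        + 2 ^ card A * (v * (2 ^ card (insert a A) * (2 * v) ^ n) * \<bar>t\<bar> ^ Suc n)"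
      using T(3)[OF t] unfolding q_def[symmetric] w_def[symmetric]
      by (intro add_mono mult_mono q_le h_le \<beta>(1) order_refl mult_nonneg_nonneg) (use \<open>v \<ge> 0\<close> in auto)
    \<comment> \<open>Each summand is \<open>4 ^ card A * w\<close>, and passing from
      \<open>A\<close> to \<open>insert a A\<close> leaves room for a factor 4.\<close>
    also have "\<dots> = 4 ^ card A * w + (2 * 2) ^ card A * w"
      unfolding power_mult_distrib w_def using insert.hyps by (simp add: power_mult_distrib)
    also have "\<dots> \<le> 4 ^ card (insert a A) * w"
      using insert.hyps \<open>w \<ge> 0\<close> by simp
    finally show ?thesis
      using insert.hyps by (simp add: q_def w_def)
  qed
  ultimately show ?case by blast
qed

section \<open>Fundamental polynomials of Hermite interpolation\<close>

lemma sum_power_le_power: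
  fixes x :: real
  assumes "x \<ge> 2"
  shows "(\<Sum>k\<le>n. x ^ k) \<le> x ^ Suc n"
proof (induction n)
  case 0
  show ?case using assms by simp
next
  case (Suc n)
  have "(\<Sum>k\<le>Suc n. x ^ k) \<le> 2 * x ^ Suc n" using Suc by simp
  also have "\<dots> \<le> x * x ^ Suc n" using assms by (intro mult_right_mono) auto
  finally show ?case by simp
qed

text \<open>Away from \<open>c i\<close> the truncated inverse need not approximate anything, and
  only its size matters. The ratio \<open>w \<ge> 2\<close> lets the geometric sum of the
  coefficient bounds be replaced by its next term.\<close>

lemma abs_poly_le_geometric:
  fixes T :: "real poly"
  assumes "degree T \<le> n" "\<And>k. \<bar>coeff T k\<bar> \<le> b * w ^ k" "w \<ge> 2" "\<bar>t\<bar> \<le> 1" "b \<ge> 0"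
  shows "\<bar>poly T t\<bar> \<le> b * w ^ Suc n"
proof -
  have "poly T t = (\<Sum>k\<le>n. coeff T k * t ^ k)"
    by (rule poly_eq_sum_atMost) (rule assms(1))
  also have "\<bar>\<dots>\<bar> \<le> (\<Sum>k\<le>n. b * w ^ k)"
  proof (rule order_trans[OF sum_abs], rule sum_mono)
    fix k
    have "\<bar>coeff T k * t ^ k\<bar> \<le> b * w ^ k * 1"
      unfolding abs_mult power_abs
      by (rule mult_mono) (use assms(2)[of k] assms in \<open>auto intro: power_le_one\<close>)
    then show "\<bar>coeff T k * t ^ k\<bar> \<le> b * w ^ k" by simp
  qed
  also have "\<dots> \<le> b * w ^ Suc n"
    unfolding sum_distrib_left[symmetric] by (intro mult_left_mono sum_power_le_power assms)
  finally show ?thesis .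
qed

text \<open>In the variable \<open>t = (x - c i) / D\<close> the linear factors become
  \<open>1 - \<beta> j * t\<close> with \<open>\<bar>\<beta> j\<bar> \<le> 1 / u\<close>, uniformly
  over the system. Here \<open>n\<close> bounds the degree of the Taylor factor, so the multiplicity
  is \<open>Suc n\<close>. The hypothesis \<open>\<delta> \<le> u * D\<close> makes the error bound
  of the truncated inverse available near \<open>c i\<close>.\<close>

lemma hermite_indicator_poly:
  fixes c :: "'a \<Rightarrow> real" and D \<delta> u :: real
  assumes "finite S" "i \<in> S" "0 < u" "u \<le> 1" "0 < D" "0 \<le> \<delta>" "\<delta> \<le> u * D"
    and sep: "\<And>j. j \<in> S \<Longrightarrow> j \<noteq> i \<Longrightarrow> \<bar>c j - c i\<bar> \<ge> u * D"
  shows "\<exists>P. Suc (degree P) \<le> card S * Suc n \<and>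
    (\<forall>x. \<bar>x - c i\<bar> \<le> \<delta> \<longrightarrow> \<bar>1 - poly P x\<bar> \<le> ((4 / u) ^ card S * (\<delta> / D)) ^ Suc n) \<and>
    (\<forall>x. \<forall>j\<in>S. j \<noteq> i \<longrightarrow> \<bar>x - c j\<bar> \<le> \<delta> \<longrightarrow> (\<forall>k\<in>S. \<bar>x - c k\<bar> \<le> D) \<longrightarrow>
      \<bar>poly P x\<bar> \<le> ((4 / u) ^ card S * (\<delta> / D)) ^ Suc n)"
proof -
  define m where "m = Suc n"
  define v where "v = 1 / u"
  define r where "r = card (S - {i})"
  define \<epsilon> where "\<epsilon> = \<delta> / D"
  \<comment> \<open>Every node other than \<open>c i\<close> is listed \<open>m\<close> times, which
    turns the multiplicity into a product of simple factors as in
    \<open>truncated_inverse\<close>.\<close>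
  define A where "A = (S - {i}) \<times> {..<m}"
  define \<beta> where "\<beta> j = D / (c j - c i)" for j
  have v: "v \<ge> 1" and \<epsilon>: "\<epsilon> \<ge> 0" "v * \<epsilon> \<le> 1"
    using assms by (simp_all add: v_def \<epsilon>_def field_simps)
  have card_S: "card S = Suc r"
    using assms(1,2) unfolding r_def by (metis card_Suc_Diff1)
  have fin: "finite (S - {i})" "finite A" using assms(1) by (auto simp: A_def)
  have card_A: "card A = r * m" by (simp add: A_def r_def card_cartesian_product)
  have \<beta>: "\<bar>\<beta> j\<bar> \<le> v" and ne: "c j - c i \<noteq> 0" if "j \<in> S - {i}" for j
  proof -
    have *: "\<bar>c j - c i\<bar> \<ge> u * D" "u * D > 0" using sep that assms by auto
    show "c j - c i \<noteq> 0" using * by auto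
    then show "\<bar>\<beta> j\<bar> \<le> v"
      using * assms(3,5) by (simp add: \<beta>_def v_def divide_simps mult.commute)
  qed
  obtain T where T: "degree T \<le> n" "\<And>k. \<bar>coeff T k\<bar> \<le> 2 ^ card A * (2 * v) ^ k"
    "\<And>t. v * \<bar>t\<bar> \<le> 1 \<Longrightarrow>
      \<bar>1 - poly T t * (\<Prod>a\<in>A. 1 - \<beta> (fst a) * t)\<bar> \<le> 4 ^ card A * (2 * v * \<bar>t\<bar>) ^ m"
    using truncated_inverse[OF fin(2), of v "\<lambda>a. \<beta> (fst a)" n] v \<beta>
    unfolding A_def m_def by fastforce
  have prod_A: "(\<Prod>a\<in>A. 1 - \<beta> (fst a) * t) = (\<Prod>j\<in>S - {i}. (1 - \<beta> j * t) ^ m)" for t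
    unfolding A_def prod.cartesian_product' by simp
  \<comment> \<open>The linear function with value 1 at \<open>c i\<close> and 0 at
    \<open>c j\<close>.\<close>
  define L where "L j = [:c j / (c j - c i), - 1 / (c j - c i):]" for j
  define P where "P = pcompose T [:- c i / D, 1 / D:] * (\<Prod>j\<in>S - {i}. L j ^ m)"
  have L: "poly (L j) x = (c j - x) / (c j - c i)" for j x
    by (simp add: L_def diff_divide_distrib)
  have L': "poly (L j) x = 1 - \<beta> j * ((x - c i) / D)" if "j \<in> S - {i}" for j x
    using ne[OF that] \<open>D > 0\<close> by (simp add: L \<beta>_def field_simps)
  have poly_P: "poly P x = poly T ((x - c i) / D) * (\<Prod>j\<in>S - {i}. poly (L j) x ^ m)" for x
    by (simp add: P_def poly_pcompose poly_prod diff_divide_distrib)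
  have "degree P \<le> n + r * m"
  proof -
    have "degree (L j ^ m) \<le> m" for j
      by (rule order_trans[OF degree_power_le]) (simp add: L_def)
    then have "degree (\<Prod>j\<in>S - {i}. L j ^ m) \<le> (\<Sum>j\<in>S - {i}. m)"
      by (intro order_trans[OF degree_prod_sum_le[OF fin(1)]] sum_mono) simp
    moreover have "degree (pcompose T [:- c i / D, 1 / D:]) \<le> n"
      using T(1) by (simp add: degree_pcompose)
    ultimately show ?thesis
      unfolding P_def by (intro order_trans[OF degree_mult_le]) (simp add: r_def)
  qed
  \<comment> \<open>Since \<open>Suc n = m\<close>, one more than \<open>n + r * m\<close> is
    exactly \<open>Suc r * m\<close>.\<close>
  then have "Suc (degree P) \<le> card S * Suc n"
    by (simp add: card_S m_def)
  moreover have "\<bar>1 - poly P x\<bar> \<le> ((4 / u) ^ card S * (\<delta> / D)) ^ Suc n" if "\<bar>x - c i\<bar> \<le> \<delta>" for x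
  proof -
    define t where "t = (x - c i) / D"
    have t: "\<bar>t\<bar> \<le> \<epsilon>" using that \<open>D > 0\<close> by (simp add: t_def \<epsilon>_def divide_right_mono)
    have "v * \<bar>t\<bar> \<le> v * \<epsilon>" using t v by (intro mult_left_mono) auto
    then have vt: "v * \<bar>t\<bar> \<le> 1" using \<epsilon> by linarith
    have "poly P x = poly T t * (\<Prod>a\<in>A. 1 - \<beta> (fst a) * t)"
      unfolding poly_P prod_A t_def by (simp add: L')
    then have "\<bar>1 - poly P x\<bar> \<le> 4 ^ card A * (2 * v * \<bar>t\<bar>) ^ m"
      using T(3)[OF vt] by simp
    \<comment> \<open>Enlarging 2 to 4 lets the constants merge:
      \<open>4 ^ (r * m) * 4 ^ m = (4 ^ Suc r) ^ m\<close>.\<close>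
    also have "\<dots> \<le> 4 ^ card A * (4 * v * \<epsilon>) ^ m"
      using t v by (intro mult_left_mono power_mono mult_mono) auto
    also have "\<dots> = (4 ^ Suc r * v ^ 1 * \<epsilon>) ^ m"
      by (simp add: card_A power_mult[symmetric] power_mult_distrib mult_ac)
    \<comment> \<open>As \<open>v \<ge> 1\<close>, the power of \<open>v\<close> may be raised; the
      weaker bound is the one shared with the other segments.\<close>
    also have "\<dots> \<le> (4 ^ Suc r * v ^ Suc r * \<epsilon>) ^ m"
      using v \<epsilon> by (intro power_mono mult_right_mono mult_left_mono power_increasing) auto
    finally show ?thesis
      by (simp add: card_S m_def v_def \<epsilon>_def power_divide)
  qed
  moreover have "\<bar>poly P x\<bar> \<le> ((4 / u) ^ card S * (\<delta> / D)) ^ Suc n"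
    if j: "j \<in> S" "j \<noteq> i" "\<bar>x - c j\<bar> \<le> \<delta>" and D: "\<forall>k\<in>S. \<bar>x - c k\<bar> \<le> D" for x j
  proof -
    define t where "t = (x - c i) / D"
    have t: "\<bar>t\<bar> \<le> 1" using D \<open>i \<in> S\<close> \<open>D > 0\<close> by (simp add: t_def)
    \<comment> \<open>Applied with \<open>\<eta> = \<delta>\<close> to the node \<open>c j\<close>
      close to \<open>x\<close>, and with \<open>\<eta> = D\<close> to the remaining nodes.\<close>
    have L_abs: "\<bar>poly (L k) x\<bar> \<le> v * (\<eta> / D)" if "k \<in> S - {i}" "\<bar>x - c k\<bar> \<le> \<eta>" for k \<eta>
    proof -
      have "\<bar>poly (L k) x\<bar> = \<bar>\<beta> k\<bar> * (\<bar>x - c k\<bar> / D)"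
        using \<open>D > 0\<close> by (simp add: L \<beta>_def abs_mult abs_minus_commute)
      also have "\<dots> \<le> v * (\<eta> / D)"
        using that \<beta> v \<open>D > 0\<close> by (intro mult_mono divide_right_mono) auto
      finally show ?thesis .
    qed
    \<comment> \<open>Only the factor of \<open>j\<close> is small. It supplies a single
      \<open>\<epsilon>\<close>, which the multiplicity turns into
      \<open>\<epsilon> ^ m\<close>.\<close>
    have "\<bar>\<Prod>k\<in>S - {i}. poly (L k) x\<bar> = \<bar>poly (L j) x\<bar> * (\<Prod>k\<in>S - {i} - {j}. \<bar>poly (L k) x\<bar>)"
      using j fin by (simp add: abs_mult abs_prod prod.remove[of _ j])
    also have "\<dots> \<le> (v * \<epsilon>) * (\<Prod>k\<in>S - {i} - {j}. v)"
    proof (intro mult_mono prod_mono conjI)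
      show "\<bar>poly (L j) x\<bar> \<le> v * \<epsilon>" using L_abs[of j \<delta>] j by (simp add: \<epsilon>_def)
      show "\<bar>poly (L k) x\<bar> \<le> v" if "k \<in> S - {i} - {j}" for k
        using L_abs[of k D] D that \<open>D > 0\<close> by simp
    qed (use v \<epsilon> in \<open>auto intro: prod_nonneg\<close>)
    also have "\<dots> = v ^ r * \<epsilon>"
    proof -
      have "r = Suc (card (S - {i} - {j}))"
        using j fin unfolding r_def by (metis DiffI card_Suc_Diff1 singletonD)
      then show ?thesis by simp
    qed
    finally have prod_le: "\<bar>\<Prod>k\<in>S - {i}. poly (L k) x\<bar> \<le> v ^ r * \<epsilon>" .
    have "\<bar>poly T t\<bar> \<le> 2 ^ card A * (2 * v) ^ m"
      unfolding m_def by (rule abs_poly_le_geometric[OF T(1,2) _ t]) (use v in auto)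
    then have "\<bar>poly P x\<bar> \<le> 2 ^ card A * (2 * v) ^ m * (v ^ r * \<epsilon>) ^ m"
      unfolding poly_P t_def[symmetric] prod_power_distrib[symmetric] abs_mult power_abs
      by (intro mult_mono power_mono prod_le) (use v in auto)
    also have "\<dots> = (2 ^ Suc r * v ^ Suc r * \<epsilon>) ^ m"
      by (simp add: card_A power_mult[symmetric] power_mult_distrib mult_ac)
    also have "\<dots> \<le> (4 ^ Suc r * v ^ Suc r * \<epsilon>) ^ m"
      using v \<epsilon> by (intro power_mono mult_right_mono) auto
    finally show ?thesis
      by (simp add: card_S m_def v_def \<epsilon>_def power_divide)
  qed
  ultimately show ?thesis by blast
qed

section \<open>From the fundamental polynomials to the best approximation\<close>

lemma best_approx_le:
  assumes "degree P \<le> n" "compact K" "K \<noteq> {}" "\<And>t. t \<in> K \<Longrightarrow> \<bar>f t - poly P t\<bar> \<le> b"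
  shows "best_approx n f K \<le> b"
proof -
  \<comment> \<open>To bound the infimum by one of its members, the norms must be bounded below.
    Their nonnegativity in turn needs each supremum to be over a bounded set, which follows from
    \<open>f - Q = (f - P) + (P - Q)\<close> and compactness of \<open>K\<close>.\<close>
  have "norm_C K (\<lambda>t. f t - poly Q t) \<ge> 0" for Q
  proof -
    have "bounded (poly (P - Q) ` K)"
      by (intro compact_imp_bounded compact_continuous_image \<open>compact K\<close> continuous_intros)
    then obtain B where B: "\<And>t. t \<in> K \<Longrightarrow> \<bar>poly (P - Q) t\<bar> \<le> B"
      by (auto simp: bounded_iff)
    have "bdd_above ((\<lambda>t. \<bar>f t - poly Q t\<bar>) ` K)"
      using assms(4) B by (intro bdd_aboveI2[of _ _ "b + B"]) (force simp: abs_le_iff)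
    with \<open>K \<noteq> {}\<close> show ?thesis
      unfolding norm_C_def by (auto intro: cSUP_upper2)
  qed
  then have "bdd_below ((\<lambda>Q. norm_C K (\<lambda>t. f t - poly Q t)) ` {Q. degree Q \<le> n})"
    by (intro bdd_belowI2)
  then have "best_approx n f K \<le> norm_C K (\<lambda>t. f t - poly P t)"
    unfolding best_approx_def using assms(1) by (intro cINF_lower) auto
  also have "\<dots> \<le> b"
    unfolding norm_C_def using assms(3,4) by (intro cSUP_least) auto
  finally show ?thesis .
qed

lemma indicator_sum_eq:
  fixes y :: "'a \<Rightarrow> real"
  assumes "finite S" "disjoint_family_on I S" "k \<in> S" "t \<in> I k"
  shows "(\<Sum>i\<in>S. y i * indicator (I i) t) = y k"
proof -
  have "(\<Sum>i\<in>S. y i * indicator (I i) t) = (\<Sum>i\<in>S. if i = k then y k else 0)"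
    using assms by (intro sum.cong) (auto simp: disjoint_family_on_def indicator_def)
  then show ?thesis using assms by simp
qed

text \<open>The factor \<open>(4 / u) ^ s\<close> comes from each fundamental polynomial, the factor
  \<open>s\<close> from adding up the \<open>s\<close> errors.\<close>

lemma best_approx_system_le:
  fixes s n :: nat and u :: real
  assumes "s \<ge> 2" "u > 0"
    and seg: "\<forall>i\<in>{1..s}. segment (I i)"
    and dis: "disjoint_family_on I {1..s}"
    and gap: "min_gap s I / diameter (system_union s I) \<ge> u"
  shows "best_approx_system n s I
    \<le> (s * (4 / u) ^ s * (half_max_length s I / diameter (system_union s I))) ^ ((n + 1) div s)"
proof -
  define S where "S = {1..s}"
  define K where "K = system_union s I"
  define D where "D = diameter K"
  define \<delta> where "\<delta> = half_max_length s I"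
  define m where "m = (n + 1) div s"
  have "\<forall>i. \<exists>a b. i \<in> S \<longrightarrow> a \<le> b \<and> I i = {a..b}"
    using seg by (auto simp: S_def segment_def)
  then obtain l h where lh: "\<And>i. i \<in> S \<Longrightarrow> l i \<le> h i" "\<And>i. i \<in> S \<Longrightarrow> I i = {l i..h i}"
    by metis
  define c where "c i = (l i + h i) / 2" for i
  have S: "finite S" "card S = s" by (simp_all add: S_def)
  have K: "compact K" "K \<noteq> {}" "K = (\<Union>i\<in>S. I i)"
    using lh \<open>s \<ge> 2\<close> unfolding K_def system_union_def S_def by (auto intro!: compact_UN)
  have c: "c i \<in> I i" "c i \<in> K" if "i \<in> S" for i
    using lh[OF that] that by (auto simp: c_def K(3))
  have dist_D: "\<bar>x - y\<bar> \<le> D" if "x \<in> K" "y \<in> K" for x y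
    using diameter_bounded_bound[OF compact_imp_bounded[OF K(1)] that]
    by (simp add: D_def dist_real_def)
  have dist_\<delta>: "\<bar>x - c i\<bar> \<le> \<delta>" if "i \<in> S" "x \<in> I i" for x i
  proof -
    have "h i - l i = measure lborel (I i)" using lh[OF that(1)] by simp
    also have "\<dots> \<le> Max ((\<lambda>i. measure lborel (I i)) ` {1..s})"
      using that by (intro Max_ge) (auto simp: S_def)
    finally have "(h i - l i) / 2 \<le> \<delta>" by (simp add: \<delta>_def half_max_length_def)
    then show ?thesis using that lh[OF that(1)] by (auto simp: c_def abs_le_iff field_simps)
  qed
  \<comment> \<open>Division by zero yields 0, so the gap hypothesis together with
    \<open>u > 0\<close> excludes \<open>D = 0\<close>.\<close>
  have "D \<noteq> 0" using gap \<open>u > 0\<close> by (auto simp: D_def K_def)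
  then have "D > 0" using diameter_ge_0[OF compact_imp_bounded[OF K(1)]] by (simp add: D_def)
  have sep: "u * D \<le> \<bar>c j - c i\<bar>" if "i \<in> S" "j \<in> S" "j \<noteq> i" for i j
  proof -
    have "u * D \<le> min_gap s I"
      using gap \<open>D > 0\<close> by (simp add: D_def K_def field_simps)
    also have "\<dots> \<le> setdist (I j) (I i)"
      unfolding min_gap_def
    proof (rule Min_le)
      have "{setdist (I i) (I j) |i j. i \<in> {1..s} \<and> j \<in> {1..s} \<and> i \<noteq> j}
          \<subseteq> (\<lambda>(i, j). setdist (I i) (I j)) ` ({1..s} \<times> {1..s})" by auto
      then show "finite {setdist (I i) (I j) |i j. i \<in> {1..s} \<and> j \<in> {1..s} \<and> i \<noteq> j}"
        by (rule finite_subset) auto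
    qed (use that in \<open>auto simp: S_def\<close>)
    also have "\<dots> \<le> \<bar>c j - c i\<bar>"
      using setdist_le_dist[OF c(1)[OF that(2)] c(1)[OF that(1)]] by (simp add: dist_real_def)
    finally show ?thesis .
  qed
  have 12: "1 \<in> S" "2 \<in> S" using \<open>s \<ge> 2\<close> by (auto simp: S_def)
  \<comment> \<open>Two midpoints lie in \<open>K\<close> and are separated by at least
    \<open>u * D\<close>, but no two points of \<open>K\<close> are farther apart than
    \<open>D\<close>.\<close>
  have "u * D \<le> 1 * D"
    using sep[OF 12] dist_D[OF c(2)[OF 12(2)] c(2)[OF 12(1)]] by simp
  then have "u \<le> 1" using \<open>D > 0\<close> by simp
  have "\<delta> \<ge> 0" using dist_\<delta>[OF 12(1) c(1)[OF 12(1)]] by simp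
  define B where "B = (4 / u) ^ s * (\<delta> / D)"
  have "B \<ge> 0" using \<open>u > 0\<close> \<open>\<delta> \<ge> 0\<close> \<open>D > 0\<close> by (simp add: B_def)
  have "best_approx n (\<lambda>t. \<Sum>i\<in>S. y i * indicator (I i) t) K \<le> (s * B) ^ m"
    if y: "y \<in> S \<rightarrow> {-1..1}" for y
  proof -
    have y_le: "\<bar>y i\<bar> \<le> 1" if "i \<in> S" for i using y that by (auto simp: Pi_def abs_le_iff)
    have f: "(\<Sum>i\<in>S. y i * indicator (I i) t) = y k" if "k \<in> S" "t \<in> I k" for k t
      using indicator_sum_eq[of S I k t y] dis that by (simp add: S_def)
    \<comment> \<open>For \<open>m = 0\<close>, that is \<open>n + 1 < s\<close>, the claimed bound
      is a zeroth power and equals 1. For \<open>\<delta> > u * D\<close> it is at least 1. Either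
      way the zero polynomial works, because \<open>\<bar>y k\<bar> \<le> 1\<close>.\<close>
    consider "m = 0 \<or> \<delta> > u * D" | n' where "m = Suc n'" "\<delta> \<le> u * D"
      by (metis not_less not0_implies_Suc)
    then show ?thesis
    proof cases
      case 1
      have "1 \<le> (s * B) ^ m"
      proof (cases "m = 0")
        case False
        have "1 \<le> (1 / u) * (\<delta> / D)"
          using 1 False \<open>u > 0\<close> \<open>D > 0\<close> by (simp add: field_simps)
        also have "1 / u \<le> 4 / u" using \<open>u > 0\<close> by (simp add: field_simps)
        also have "4 / u \<le> (4 / u) ^ s"
          using \<open>u > 0\<close> \<open>u \<le> 1\<close> \<open>s \<ge> 2\<close> by (intro self_le_power) (auto simp: field_simps)
        finally have "1 \<le> B"
          unfolding B_def using \<open>\<delta> \<ge> 0\<close> \<open>D > 0\<close> by (simp add: mult_right_mono divide_right_mono)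
        then have "1 * 1 \<le> s * B" using \<open>s \<ge> 2\<close> by (intro mult_mono) auto
        then show ?thesis by (simp add: one_le_power)
      qed simp
      then have "\<bar>y k\<bar> \<le> (s * B) ^ m" if "k \<in> S" for k
        using y_le[OF that] by linarith
      then show ?thesis
        using f K by (intro best_approx_le[of 0]) auto
    next
      case (2 n')
      have "\<exists>P. Suc (degree P) \<le> s * m \<and>
          (\<forall>x. \<bar>x - c i\<bar> \<le> \<delta> \<longrightarrow> \<bar>1 - poly P x\<bar> \<le> B ^ m) \<and>
          (\<forall>x. \<forall>j\<in>S. j \<noteq> i \<longrightarrow> \<bar>x - c j\<bar> \<le> \<delta> \<longrightarrow> (\<forall>k\<in>S. \<bar>x - c k\<bar> \<le> D) \<longrightarrow>
            \<bar>poly P x\<bar> \<le> B ^ m)" if "i \<in> S" for i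
        unfolding 2(1) B_def S(2)[symmetric]
        by (rule hermite_indicator_poly) (use S that assms(2) \<open>u \<le> 1\<close> \<open>D > 0\<close> \<open>\<delta> \<ge> 0\<close> 2(2) sep in auto)
      then obtain P where P: "\<And>i. i \<in> S \<Longrightarrow> Suc (degree (P i)) \<le> s * m"
          "\<And>i x. i \<in> S \<Longrightarrow> \<bar>x - c i\<bar> \<le> \<delta> \<Longrightarrow> \<bar>1 - poly (P i) x\<bar> \<le> B ^ m"
          "\<And>i j x. i \<in> S \<Longrightarrow> j \<in> S \<Longrightarrow> j \<noteq> i \<Longrightarrow> \<bar>x - c j\<bar> \<le> \<delta> \<Longrightarrow>
            \<forall>k\<in>S. \<bar>x - c k\<bar> \<le> D \<Longrightarrow> \<bar>poly (P i) x\<bar> \<le> B ^ m"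
        by metis
      define Q where "Q = (\<Sum>i\<in>S. smult (y i) (P i))"
      \<comment> \<open>The rounding down in \<open>m\<close> is exactly what keeps the degrees, at
        most \<open>s * m - 1\<close>, within \<open>n\<close>.\<close>
      have "s * m \<le> n + 1" by (simp add: m_def)
      then have "degree (P i) \<le> n" if "i \<in> S" for i using P(1)[OF that] by linarith
      then have "degree Q \<le> n"
        unfolding Q_def by (intro degree_sum_le S(1)) (auto intro: order_trans[OF degree_smult_le])
      moreover have "\<bar>(\<Sum>i\<in>S. y i * indicator (I i) t) - poly Q t\<bar> \<le> (s * B) ^ m"
        if "t \<in> K" for t
      proof -
        obtain k where k: "k \<in> S" "t \<in> I k" using \<open>t \<in> K\<close> K(3) by auto
        \<comment> \<open>Expanding \<open>y k\<close> over all indices splits the error at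
          \<open>t\<close> into the deviations of the \<open>P i\<close> from the indicator values 1
          for \<open>i = k\<close> and 0 otherwise.\<close>
        have "y k = (\<Sum>i\<in>S. y i * of_bool (i = k))"
          using k S(1) by simp
        then have "(\<Sum>i\<in>S. y i * indicator (I i) t) - poly Q t
            = (\<Sum>i\<in>S. y i * (of_bool (i = k) - poly (P i) t))"
          unfolding f[OF k] Q_def poly_sum poly_smult by (simp add: right_diff_distrib sum_subtractf)
        also have "\<bar>\<dots>\<bar> \<le> (\<Sum>i\<in>S. B ^ m)"
        proof (rule order_trans[OF sum_abs], rule sum_mono)
          fix i assume i: "i \<in> S"
          have "\<bar>of_bool (i = k) - poly (P i) t\<bar> \<le> B ^ m"
            using P(2)[OF i, of t] P(3)[OF i k(1), of t] dist_\<delta>[OF k] dist_D[OF \<open>t \<in> K\<close> c(2)]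
            by (cases "i = k") auto
          then show "\<bar>y i * (of_bool (i = k) - poly (P i) t)\<bar> \<le> B ^ m"
            using mult_mono[OF y_le[OF i], of "\<bar>of_bool (i = k) - poly (P i) t\<bar>" "B ^ m"]
            by (simp add: abs_mult)
        qed
        also have "\<dots> = real s * B ^ m" using S(2) by simp
        \<comment> \<open>The factor \<open>s\<close> is moved inside the power, at the cost of
          \<open>s \<le> s ^ m\<close>, valid since \<open>m \<ge> 1\<close>.\<close>
        also have "\<dots> \<le> real s ^ m * B ^ m"
          using \<open>s \<ge> 2\<close> \<open>B \<ge> 0\<close> 2(1) by (intro mult_right_mono self_le_power) auto
        finally show ?thesis by (simp add: power_mult_distrib)
      qed
      ultimately show ?thesis using K by (intro best_approx_le)
    qed
  qed
  then have "best_approx_system n s I \<le> (s * B) ^ m"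
    unfolding best_approx_system_def S_def[symmetric] K_def[symmetric]
    \<comment> \<open>\<open>cSUP_least\<close> asks for a nonempty index set; the cube of
      admissible \<open>y\<close> contains zero.\<close>
    by (intro cSUP_least) (auto intro!: exI[of _ "\<lambda>_. 0"] simp: Pi_eq_empty)
  then show ?thesis by (simp add: B_def m_def \<delta>_def D_def K_def mult.assoc)
qed

theorem mainTheorem3:
  fixes s :: nat and u :: real
  assumes "s \<ge> 2" and "u > 0"
  shows "\<exists>C::real. C > 0 \<and>
    (\<forall>I :: nat \<Rightarrow> real set.
       (\<forall>i\<in>{1..s}. segment (I i)) \<longrightarrow>
       disjoint_family_on I {1..s} \<longrightarrow>
       min_gap s I / diameter (system_union s I) \<ge> u \<longrightarrow>
       (\<forall>n::nat. best_approx_system n s I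
           \<le> (C * (half_max_length s I / diameter (system_union s I))) ^ ((n + 1) div s)))"
proof (intro exI conjI allI impI)
  show "0 < real s * (4 / u) ^ s" using assms by simp
qed (rule best_approx_system_le[OF assms])

end
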